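(* Let $\mathcal{A}$ be the finite arc set of a directed graph, let $n_{ij}=n_{ji}$ be positive integers, and let $\mathbf{x}=(x_{ij})_{(i,j)\in\mathcal{A}}$, $x_{ij}\ge 0$, be a fixed vector of arc flows. For $(i,j)\in\mathcal{A}$ put $J_{ij}(z_{ij}) := t_{ij}(x_{ij},z_{ij})\,x_{ij}$, where $t_{ij}$ is the latency function of arc $(i,j)$. Let $\hat J_{ij}:[0,n_{ij}]\to\mathbb{R}$ be the continuous piecewise affine function with breakpoints at the integers, with intercept $\hat J_{ij}(0)=\beta^0_{ij}$ and with slope $\beta^{(k)}_{ij}$ on the segment $(k-1,k)$, $k=1,\dots,n_{ij}$. Consider the lane assignment problem (A) $\displaystyle \min_{\mathbf{z}} \ J(\mathbf{z}) := \sum_{(i,j)\in\mathcal{A}} J_{ij}(z_{ij})$ subject to $z_{ij}+z_{ji}\le n_{ij}$ for all $(i,j)\in\mathcal{A}$, and $z_{ij}\in\mathbb{Z}_{\ge 0}$ for all $(i,j)\in\mathcal{A}$, and the problem (B) $\displaystyle \min_{\boldsymbol{\varepsilon}} \ \hat J(\boldsymbol{\varepsilon}) := \sum_{(i,j)\in\mathcal{A}} \Big(\beta^0_{ij}+\sum_{k=1}^{n_{ij}}\beta^{(k)}_{ij}\varepsilon^{(k)}_{ij}\Big)$ subject to $\sum_{k=1}^{n_{ij}}\big(\varepsilon^{(k)}_{ij}+\varepsilon^{(k)}_{ji}\big)\le n_{ij}$ for all $(i,j)\in\mathcal{A}$; $\sum_{k=1}^{l}\varepsilon^{(k)}_{ij}\le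 \theta^{(l)}_{ij}$ for all $(i,j)\in\mathcal{A}$, $l=1,\dots,n_{ij}$, where $\theta^{(l)}_{ij}=l$; $\boldsymbol{\varepsilon}_{ij}\in\{0,1\}^{n_{ij}}$ for all $(i,j)\in\mathcal{A}$. Suppose that for every $(i,j)\in\mathcal{A}$ the values of $\hat J_{ij}$ at its breakpoints coincide with those of $J_{ij}$, i.e. $\hat J_{ij}(m)=J_{ij}(m)$ for $m=0,1,\dots,n_{ij}$, and that $J_{ij}$ is convex and monotonically decreasing. Then solving (B) is equivalent to solving (A) under the correspondence $z_{ij}=\sum_{k=1}^{n_{ij}}\varepsilon^{(k)}_{ij}$: the two problems have the same optimal value; if $\boldsymbol{\varepsilon}$ is optimal for (B), then $\mathbf{z}$ given by $z_{ij}=\sum_{k}\varepsilon^{(k)}_{ij}$ is optimal for (A); and every optimal $\mathbf{z}$ of (A) arises in this way from some optimal $\boldsymbol{\varepsilon}$ of (B).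
   Context: A transportation network is a directed graph with finite arc set $\mathcal{A}$ (arcs $(i,j)$ with $i\neq j$). The number of lanes assigned to arc $(i,j)$ is $z_{ij}$, and $n_{ij}=n_{ji}$ is the total number of lanes available on $(i,j)$ and $(j,i)$ together. If $(j,i)\notin\mathcal{A}$, the terms $z_{ji}$, $\varepsilon^{(k)}_{ji}$ are read as $0$. The latency (travel time) function $t_{ij}:\mathbb{R}_{\ge0}\times\mathbb{Z}_{\ge0}\to\mathbb{R}_{\ge0}$ is given, for $z_{ij}\geq 1$, by $t_{ij}(x_{ij},z_{ij})=t^0_{ij} f\big(x_{ij}/(c_{ij}z_{ij})\big)$, where $t^0_{ij}>0$ is the free-flow travel time, $c_{ij}>0$ is the capacity per lane, and $f$ is strictly increasing, positive, and continuously differentiable with $f(0)=1$ (for instance $f(x)=1+0.15x^4$). At $z_{ij}=0$ its value is some finite nonnegative real number. Since $J_{ij}$ is a real-valued function on the integers $\{0,\dots,n_{ij}\}$, convex means that the increments $J_{ij}(m)-J_{ij}(m-1)$ are nondecreasing in $m\in\{1,\dots,n_{ij}\}$, and monotonically decreasing means $J_{ij}(m)\le J_{ij}(m-1)$. The vector $\boldsymbol{\varepsilon}_{ij}=(\varepsilon^{(1)}_{ij},\dots,\varepsilon^{(n_{ij})}_{ij})$ consists of slack variables, each corresponding to the assignment of one lane to arc $(i,j)$, and $\boldsymbol{\varepsilon}=(\boldsymbol{\varepsilon}_{ij})_{(i,j)\in\mathcal{A}}$. The thresholds are $\boldsymbol{\theta}_{ij}=(1,\dots,n_{ij})$, with $l$-th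 entry $\theta^{(l)}_{ij}=l$. *)

theory Defs
  imports "HOL-Analysis.Analysis"
begin

(* C1 on the closed half-line: the derivative at 0 is the one-sided one. *)
definition latency_shape :: "(real \<Rightarrow> real) \<Rightarrow> bool" where
  "latency_shape f \<longleftrightarrow>
     strict_mono_on {0..} f \<and> (\<forall>u\<ge>0. 0 < f u) \<and> f 0 = 1 \<and>
     (\<exists>f'. (\<forall>u\<ge>0. (f has_real_derivative f' u) (at u within {0..})) \<and> continuous_on {0..} f')"

(* The value at zero lanes is an arbitrary nonnegative real, possibly depending on the flow. *)
definition is_latency ::
  "(real \<Rightarrow> real) \<Rightarrow> real \<Rightarrow> real \<Rightarrow> (real \<Rightarrow> nat \<Rightarrow> real) \<Rightarrow> bool" where
  "is_latency f t0 c t \<longleftrightarrow>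
     (\<forall>y\<ge>0. \<forall>z\<ge>1. t y z = t0 * f (y / (c * real z))) \<and> (\<forall>y\<ge>0. 0 \<le> t y 0)"

definition arc_cost ::
  "('v \<Rightarrow> 'v \<Rightarrow> real \<Rightarrow> nat \<Rightarrow> real) \<Rightarrow> ('v \<Rightarrow> 'v \<Rightarrow> real) \<Rightarrow> 'v \<Rightarrow> 'v \<Rightarrow> nat \<Rightarrow> real" where
  "arc_cost t x i j m = t i j (x i j) m * x i j"

definition int_convex :: "nat \<Rightarrow> (nat \<Rightarrow> real) \<Rightarrow> bool" where
  "int_convex n J \<longleftrightarrow> mono_on {1..n} (\<lambda>m. J m - J (m - 1))"

definition int_decreasing :: "nat \<Rightarrow> (nat \<Rightarrow> real) \<Rightarrow> bool" where
  "int_decreasing n J \<longleftrightarrow> (\<forall>m\<in>{1..n}. J m \<le> J (m - 1))"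

definition piecewise_affine :: "nat \<Rightarrow> real \<Rightarrow> (nat \<Rightarrow> real) \<Rightarrow> (real \<Rightarrow> real) \<Rightarrow> bool" where
  "piecewise_affine n b0 b h \<longleftrightarrow>
     continuous_on {0..real n} h \<and> h 0 = b0 \<and>
     (\<forall>k\<in>{1..n}. \<exists>a. \<forall>y\<in>{real k - 1<..<real k}. h y = a + b k * y)"

(* Arc-indexed vectors are functions vanishing off the arc set, which realises the convention
   that the terms of a missing reverse arc are read as 0 and makes vectors equal as functions. *)
definition feasible_A :: "('v \<times> 'v) set \<Rightarrow> ('v \<Rightarrow> 'v \<Rightarrow> nat) \<Rightarrow> ('v \<Rightarrow> 'v \<Rightarrow> nat) set" where
  "feasible_A A n = {z.
     (\<forall>i j. (i, j) \<notin> A \<longrightarrow> z i j = 0) \<and>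
     (\<forall>(i, j)\<in>A. z i j + z j i \<le> n i j)}"

definition objective_A ::
  "('v \<times> 'v) set \<Rightarrow> ('v \<Rightarrow> 'v \<Rightarrow> nat \<Rightarrow> real) \<Rightarrow> ('v \<Rightarrow> 'v \<Rightarrow> nat) \<Rightarrow> real" where
  "objective_A A J z = (\<Sum>(i, j)\<in>A. J i j (z i j))"

(* Likewise e i j k vanishes unless (i, j) is an arc and k is in {1..n i j}. *)
definition feasible_B :: "('v \<times> 'v) set \<Rightarrow> ('v \<Rightarrow> 'v \<Rightarrow> nat) \<Rightarrow> ('v \<Rightarrow> 'v \<Rightarrow> nat \<Rightarrow> nat) set" where
  "feasible_B A n = {e.
     (\<forall>i j k. (i, j) \<notin> A \<or> k \<notin> {1..n i j} \<longrightarrow> e i j k = 0) \<and>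
     (\<forall>(i, j)\<in>A. (\<Sum>k = 1..n i j. e i j k + e j i k) \<le> n i j) \<and>
     (\<forall>(i, j)\<in>A. \<forall>l\<in>{1..n i j}. (\<Sum>k = 1..l. e i j k) \<le> l) \<and>
     (\<forall>(i, j)\<in>A. \<forall>k\<in>{1..n i j}. e i j k \<in> {0, 1})}"

definition objective_B ::
  "('v \<times> 'v) set \<Rightarrow> ('v \<Rightarrow> 'v \<Rightarrow> nat) \<Rightarrow> ('v \<Rightarrow> 'v \<Rightarrow> real) \<Rightarrow> ('v \<Rightarrow> 'v \<Rightarrow> nat \<Rightarrow> real) \<Rightarrow>
   ('v \<Rightarrow> 'v \<Rightarrow> nat \<Rightarrow> nat) \<Rightarrow> real" where
  "objective_B A n b0 b e =
     (\<Sum>(i, j)\<in>A. b0 i j + (\<Sum>k = 1..n i j. b i j k * real (e i j k)))"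

definition lanes_of :: "('v \<Rightarrow> 'v \<Rightarrow> nat) \<Rightarrow> ('v \<Rightarrow> 'v \<Rightarrow> nat \<Rightarrow> nat) \<Rightarrow> 'v \<Rightarrow> 'v \<Rightarrow> nat" where
  "lanes_of n e i j = (\<Sum>k = 1..n i j. e i j k)"

(* Extended reals, so that the infimum is meaningful without a boundedness side condition. *)
definition optimal_value :: "'a set \<Rightarrow> ('a \<Rightarrow> real) \<Rightarrow> ereal" where
  "optimal_value S g = (INF s\<in>S. ereal (g s))"

definition optimal_on :: "'a set \<Rightarrow> ('a \<Rightarrow> real) \<Rightarrow> 'a \<Rightarrow> bool" where
  "optimal_on S g s \<longleftrightarrow> is_arg_min g (\<lambda>r. r \<in> S) s"

end

theory Submission
  imports Defs
begin

text \<open>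
  The breakpoint values determine the slopes: \<open>\<beta>\<^sup>k = J k - J (k - 1)\<close> on every arc
  (\<open>piecewise_affine_slope\<close>). Hence choosing the lane variables as an initial segment
  \<open>1, \<dots>, z\<close> telescopes to the exact cost \<open>J z\<close> (\<open>fill_cost\<close>), whereas any other choice of
  \<open>z\<close> lane variables costs at least as much, because convexity makes the slopes
  nondecreasing, so that the first \<open>z\<close> of them are the cheapest (\<open>slopes_select_ge\<close>).

  Counting lanes therefore maps the second problem to the first without raising the
  objective, and filling lanes from the bottom maps the first problem back without changing it;
  counting after filling is the identity. Any two minimisation problems linked in this way are
  equivalent (\<open>equivalent_minimisation\<close>).
\<close>

lemma piecewise_affine_slope:
  assumes h: "piecewise_affine n b0 b h" and k: "k \<in> {1..n}"
  shows "b k = h (real k) - h (real (k - 1))"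
proof -
  from k have k1: "real (k - 1) = real k - 1" by auto
  obtain a where a: "\<And>y. y \<in> {real k - 1<..<real k} \<Longrightarrow> h y = a + b k * y"
    using h k unfolding piecewise_affine_def by blast
  have cl: "closure {real k - 1<..<real k} = {real k - 1..real k}"
    by (intro closure_greaterThanLessThan) simp
  have "continuous_on {real k - 1..real k} h"
    using h k unfolding piecewise_affine_def by (auto elim!: continuous_on_subset)
  then have cont: "continuous_on (closure {real k - 1<..<real k}) (\<lambda>y. h y - (a + b k * y))"
    unfolding cl by (intro continuous_intros)
  \<comment> \<open>By continuity the affine formula extends from the open segment to its end points.\<close>
  have affine: "h y = a + b k * y" if "y \<in> {real k - 1..real k}" for y
    using continuous_constant_on_closure[OF cont, of 0 y] a that unfolding cl by simp
  show ?thesis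
    using affine[of "real k"] affine[of "real k - 1"] unfolding k1 by (simp add: algebra_simps)
qed

text \<open>
  The induction processes the slopes in increasing order. If slope \<open>Suc N\<close> is selected after
  \<open>m \<le> N\<close> earlier ones, it is at least the increment from \<open>m\<close> to \<open>Suc m\<close>, which is what the
  right-hand side grows by.
\<close>

lemma slopes_select_ge:
  fixes e :: "nat \<Rightarrow> nat"
  assumes conv: "int_convex n J"
    and b: "\<And>k. k \<in> {1..n} \<Longrightarrow> b k = J k - J (k - 1)"
    and e: "\<And>k. k \<in> {1..n} \<Longrightarrow> e k \<in> {0, 1}"
  shows "N \<le> n \<Longrightarrow> J (\<Sum>k=1..N. e k) - J 0 \<le> (\<Sum>k=1..N. b k * real (e k))"
proof (induction N)
  case 0
  then show ?case by simp
next
  case (Suc N)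
  define m where "m = (\<Sum>k=1..N. e k)"
  have "m \<le> (\<Sum>k=1..N. 1)"
    unfolding m_def using e Suc.prems by (intro sum_mono) fastforce
  then have m: "m \<le> N" by simp
  have IH: "J m - J 0 \<le> (\<Sum>k=1..N. b k * real (e k))"
    using Suc unfolding m_def by simp
  have "J (Suc m) - J (Suc m - 1) \<le> J (Suc N) - J (Suc N - 1)"
    using conv m Suc.prems unfolding int_convex_def
    by (intro mono_onD[of "{1..n}" "\<lambda>m. J m - J (m - 1)"]) auto
  then have slope: "J (Suc m) - J m \<le> b (Suc N)"
    using b[of "Suc N"] Suc.prems by simp
  from e[of "Suc N"] Suc.prems consider "e (Suc N) = 0" | "e (Suc N) = 1" by auto
  then show ?case
    using IH slope unfolding m_def by cases simp_all
qed

definition fill :: "('v \<Rightarrow> 'v \<Rightarrow> nat) \<Rightarrow> 'v \<Rightarrow> 'v \<Rightarrow> nat \<Rightarrow> nat" where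
  "fill z i j k = of_bool (k \<in> {1..z i j})"

lemma sum_fill:
  fixes g :: "nat \<Rightarrow> 'a::semiring_1"
  assumes "z i j \<le> N"
  shows "(\<Sum>k=1..N. g k * of_nat (fill z i j k)) = (\<Sum>k=1..z i j. g k)"
proof -
  have "(\<Sum>k=1..N. g k * of_nat (fill z i j k)) = (\<Sum>k\<in>{1..N}. if k \<in> {1..z i j} then g k else 0)"
    by (intro sum.cong) (auto simp: fill_def)
  also have "\<dots> = (\<Sum>k\<in>{1..N} \<inter> {1..z i j}. g k)"
    by (rule sum.inter_restrict[symmetric]) simp
  also have "{1..N} \<inter> {1..z i j} = {1..z i j}" using assms by auto
  finally show ?thesis .
qed

lemma fill_cost:
  assumes b: "\<And>k. k \<in> {1..n} \<Longrightarrow> b k = J k - J (k - 1)" and z: "z i j \<le> n"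
  shows "(\<Sum>k=1..n. b k * real (fill z i j k)) = J (z i j) - J 0"
proof -
  have "(\<Sum>k=1..m. b k) = J m - J 0" if "m \<le> n" for m
    using that by (induction m) (simp_all add: b)
  with z sum_fill[of z i j n b] show ?thesis by simp
qed

lemma lanes_of_fill:
  assumes "z \<in> feasible_A A n"
  shows "lanes_of n (fill z) = z"
proof (intro ext)
  fix i j
  have "z i j \<le> n i j"
    using assms unfolding feasible_A_def by (cases "(i, j) \<in> A") fastforce+
  then show "lanes_of n (fill z) i j = z i j"
    using sum_fill[of z i j "n i j" "\<lambda>_. 1::nat"] by (simp add: lanes_of_def)
qed

lemma lanes_of_feasible:
  assumes e: "e \<in> feasible_B A n" and n: "\<forall>(i, j)\<in>A. n i j = n j i"
  shows "lanes_of n e \<in> feasible_A A n"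
proof -
  have "lanes_of n e i j + lanes_of n e j i \<le> n i j" if "(i, j) \<in> A" for i j
  proof -
    have "n j i = n i j" using n that by auto
    then show ?thesis
      using e that unfolding feasible_B_def lanes_of_def by (auto simp: sum.distrib)
  qed
  then show ?thesis
    using e unfolding feasible_A_def feasible_B_def by (auto simp: lanes_of_def)
qed

lemma fill_feasible:
  assumes z: "z \<in> feasible_A A n" and n: "\<forall>(i, j)\<in>A. n i j = n j i"
  shows "fill z \<in> feasible_B A n"
proof -
  have zle: "z i j + z j i \<le> n i j" if "(i, j) \<in> A" for i j
    using z that unfolding feasible_A_def by auto
  have off: "fill z i j k = 0" if "(i, j) \<notin> A \<or> k \<notin> {1..n i j}" for i j k
    using that z zle[of i j] unfolding feasible_A_def fill_def by force
  have capacity: "(\<Sum>k=1..n i j. fill z i j k + fill z j i k) \<le> n i j" if "(i, j) \<in> A" for i j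
  proof -
    have "n j i = n i j" using n that by auto
    then have "(\<Sum>k=1..n i j. fill z i j k + fill z j i k)
        = lanes_of n (fill z) i j + lanes_of n (fill z) j i"
      by (simp add: lanes_of_def sum.distrib)
    then show ?thesis using zle[OF that] by (simp add: lanes_of_fill[OF z])
  qed
  have threshold: "(\<Sum>k=1..l. fill z i j k) \<le> l" for i j l
  proof -
    have "(\<Sum>k=1..l. fill z i j k) \<le> (\<Sum>k=1..l. 1)"
      by (intro sum_mono) (simp add: fill_def)
    then show ?thesis by simp
  qed
  show ?thesis
    unfolding feasible_B_def using off capacity threshold by (auto simp: fill_def)
qed

text \<open>
  The optimal values are compared as infima, so the conclusion holds whether or not they are
  attained. Optimality transfers because each map sends a point to one that is at least as good.
\<close>

lemma equivalent_minimisation: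
  assumes p: "\<And>e. e \<in> T \<Longrightarrow> p e \<in> S" "\<And>e. e \<in> T \<Longrightarrow> g (p e) \<le> h e"
    and q: "\<And>z. z \<in> S \<Longrightarrow> q z \<in> T" "\<And>z. z \<in> S \<Longrightarrow> h (q z) \<le> g z"
    and pq: "\<And>z. z \<in> S \<Longrightarrow> p (q z) = z"
  shows "optimal_value S g = optimal_value T h \<and>
         (\<forall>e. optimal_on T h e \<longrightarrow> optimal_on S g (p e)) \<and>
         (\<forall>z. optimal_on S g z \<longrightarrow> (\<exists>e. optimal_on T h e \<and> z = p e))"
proof (intro conjI allI impI)
  show "optimal_value S g = optimal_value T h"
    unfolding optimal_value_def
  proof (intro antisym INF_mono)
    show "\<exists>z\<in>S. ereal (g z) \<le> ereal (h e)" if "e \<in> T" for e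
      using p that by auto
    show "\<exists>e\<in>T. ereal (h e) \<le> ereal (g z)" if "z \<in> S" for z
      using q that by auto
  qed
next
  fix e assume "optimal_on T h e"
  then have e: "e \<in> T" "\<And>e'. e' \<in> T \<Longrightarrow> h e \<le> h e'"
    by (auto simp: optimal_on_def is_arg_min_linorder)
  have "g (p e) \<le> g z" if "z \<in> S" for z
    using p(2)[OF e(1)] e(2)[OF q(1)[OF that]] q(2)[OF that] by linarith
  then show "optimal_on S g (p e)"
    using p(1)[OF e(1)] by (simp add: optimal_on_def is_arg_min_linorder)
next
  fix z assume "optimal_on S g z"
  then have z: "z \<in> S" "\<And>z'. z' \<in> S \<Longrightarrow> g z \<le> g z'"
    by (auto simp: optimal_on_def is_arg_min_linorder)
  have "h (q z) \<le> h e" if "e \<in> T" for e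
    using q(2)[OF z(1)] z(2)[OF p(1)[OF that]] p(2)[OF that] by linarith
  then have "optimal_on T h (q z)"
    using q(1)[OF z(1)] by (simp add: optimal_on_def is_arg_min_linorder)
  then show "\<exists>e. optimal_on T h e \<and> z = p e"
    using pq[OF z(1)] by metis
qed

theorem mainTheorem1:
  fixes A :: "('v \<times> 'v) set"
    and n :: "'v \<Rightarrow> 'v \<Rightarrow> nat"
    and x t0 c :: "'v \<Rightarrow> 'v \<Rightarrow> real"
    and f :: "real \<Rightarrow> real"
    and t :: "'v \<Rightarrow> 'v \<Rightarrow> real \<Rightarrow> nat \<Rightarrow> real"
    and \<beta>0 :: "'v \<Rightarrow> 'v \<Rightarrow> real"
    and \<beta> :: "'v \<Rightarrow> 'v \<Rightarrow> nat \<Rightarrow> real"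
    and Jhat :: "'v \<Rightarrow> 'v \<Rightarrow> real \<Rightarrow> real"
  assumes "finite A"
    and "\<forall>(i, j)\<in>A. i \<noteq> j"
    and "\<forall>(i, j)\<in>A. 0 < n i j \<and> n i j = n j i"
    and "\<forall>(i, j)\<in>A. 0 \<le> x i j"
    and "latency_shape f"
    and "\<forall>(i, j)\<in>A. 0 < t0 i j \<and> 0 < c i j \<and> is_latency f (t0 i j) (c i j) (t i j)"
    and "\<forall>(i, j)\<in>A. piecewise_affine (n i j) (\<beta>0 i j) (\<beta> i j) (Jhat i j)"
    and "\<forall>(i, j)\<in>A. \<forall>m\<in>{0..n i j}. Jhat i j (real m) = arc_cost t x i j m"
    and "\<forall>(i, j)\<in>A. int_convex (n i j) (arc_cost t x i j)"
    and "\<forall>(i, j)\<in>A. int_decreasing (n i j) (arc_cost t x i j)"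
  shows "optimal_value (feasible_A A n) (objective_A A (arc_cost t x)) =
           optimal_value (feasible_B A n) (objective_B A n \<beta>0 \<beta>) \<and>
         (\<forall>\<epsilon>. optimal_on (feasible_B A n) (objective_B A n \<beta>0 \<beta>) \<epsilon> \<longrightarrow>
           optimal_on (feasible_A A n) (objective_A A (arc_cost t x)) (lanes_of n \<epsilon>)) \<and>
         (\<forall>z. optimal_on (feasible_A A n) (objective_A A (arc_cost t x)) z \<longrightarrow>
           (\<exists>\<epsilon>. optimal_on (feasible_B A n) (objective_B A n \<beta>0 \<beta>) \<epsilon> \<and> z = lanes_of n \<epsilon>))"
proof -
  let ?J = "arc_cost t x"
  have n: "\<forall>(i, j)\<in>A. n i j = n j i" using assms(3) by auto
  have \<beta>0: "\<beta>0 i j = ?J i j 0" if "(i, j) \<in> A" for i j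
  proof -
    have "Jhat i j (real 0) = ?J i j 0" using assms(8) that by fastforce
    moreover have "Jhat i j 0 = \<beta>0 i j" using assms(7) that by (auto simp: piecewise_affine_def)
    ultimately show ?thesis by simp
  qed
  have \<beta>: "\<beta> i j k = ?J i j k - ?J i j (k - 1)" if ij: "(i, j) \<in> A" and k: "k \<in> {1..n i j}" for i j k
  proof -
    have "\<beta> i j k = Jhat i j (real k) - Jhat i j (real (k - 1))"
      using assms(7) ij k by (intro piecewise_affine_slope) auto
    moreover have "Jhat i j (real k) = ?J i j k" "Jhat i j (real (k - 1)) = ?J i j (k - 1)"
      using assms(8) ij k by fastforce+
    ultimately show ?thesis by metis
  qed
  have count_le: "objective_A A ?J (lanes_of n e) \<le> objective_B A n \<beta>0 \<beta> e"
    if e: "e \<in> feasible_B A n" for e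
    unfolding objective_A_def objective_B_def
  proof (intro sum_mono, clarify)
    fix i j assume ij: "(i, j) \<in> A"
    have "?J i j (\<Sum>k=1..n i j. e i j k) - ?J i j 0 \<le> (\<Sum>k=1..n i j. \<beta> i j k * real (e i j k))"
    proof (rule slopes_select_ge[OF _ _ _ order_refl])
      show "int_convex (n i j) (?J i j)" using assms(9) ij by auto
      show "e i j k \<in> {0, 1}" if "k \<in> {1..n i j}" for k
        using e ij that unfolding feasible_B_def by blast
    qed (rule \<beta>[OF ij])
    then show "?J i j (lanes_of n e i j) \<le> \<beta>0 i j + (\<Sum>k=1..n i j. \<beta> i j k * real (e i j k))"
      by (simp add: \<beta>0[OF ij] lanes_of_def)
  qed
  have fill_eq: "objective_B A n \<beta>0 \<beta> (fill z) = objective_A A ?J z"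
    if z: "z \<in> feasible_A A n" for z
    unfolding objective_A_def objective_B_def
  proof (intro sum.cong refl, clarify)
    fix i j assume ij: "(i, j) \<in> A"
    then have "z i j \<le> n i j" using z unfolding feasible_A_def by fastforce
    then show "\<beta>0 i j + (\<Sum>k=1..n i j. \<beta> i j k * real (fill z i j k)) = ?J i j (z i j)"
      using fill_cost[of "n i j" "\<beta> i j" "?J i j" z i j] \<beta>[OF ij] by (simp add: \<beta>0[OF ij])
  qed
  show ?thesis
    by (rule equivalent_minimisation[where q = fill])
       (simp_all add: lanes_of_feasible[OF _ n] fill_feasible[OF _ n] count_le fill_eq lanes_of_fill)
qed

end
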